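(* Let $\varphi_0$ be an $m\times m$ matrix of functions solving the semi-discrete matrix Riemann equation $$\varphi_t=(\varphi^+-\varphi)\,\varphi .$$ Let $\boldsymbol{A},\boldsymbol{B}$ be constant complex $n\times n$ matrices, and let $\boldsymbol{U}$ ($m\times n$) and $\boldsymbol{V}$ ($n\times m$) be matrices of functions solving $$\boldsymbol{U}_t=\boldsymbol{U}^+\boldsymbol{A}+(\varphi_0^+-\varphi_0)\,\boldsymbol{U},\qquad \boldsymbol{V}_t=-\boldsymbol{V}\varphi_0^+,\qquad \boldsymbol{B}\boldsymbol{V}^-=\boldsymbol{V}\varphi_0 .$$ Let $$\tilde{\boldsymbol{X}}=\boldsymbol{C}^-+\int_0^t\boldsymbol{V}^-\boldsymbol{U}\,dt ,$$ where the $n\times n$ matrix $\boldsymbol{C}$ (a function of the discrete variable) does not depend on $t$ and satisfies $$\boldsymbol{C}\boldsymbol{A}-\boldsymbol{B}\boldsymbol{C}^-=\boldsymbol{V}\boldsymbol{U}\big|_{t=0},$$ and assume that $\tilde{\boldsymbol{X}}$ is invertible. Then $$\varphi=\varphi_0+\boldsymbol{U}\tilde{\boldsymbol{X}}^{-1}\boldsymbol{V}^-$$ is again a solution of $\varphi_t=(\varphi^+-\varphi)\,\varphi$.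
   Context: All functions are (complex-valued) functions of $(t,k)\in\mathbb{R}\times\mathbb{Z}$, smooth in $t$. For a (matrix) function $f$, $f^+(t,k)=f(t,k+1)$, $f^-(t,k)=f(t,k-1)$, and a subscript $t$ denotes the partial derivative with respect to $t$. "Constant" means independent of $t$ and $k$. *)

theory Defs
  imports "HOL-Analysis.Analysis"
begin

text \<open>
  A function of \<open>(t, k)\<close> is a map \<open>f :: real \<Rightarrow> int \<Rightarrow> _\<close>. An \<open>m \<times> n\<close> matrix of functions has values
  in \<open>complex ^ 'n ^ 'm\<close> (rows are indexed by \<open>'m\<close>).
\<close>

definition shift_fwd :: "(real \<Rightarrow> int \<Rightarrow> 'a) \<Rightarrow> real \<Rightarrow> int \<Rightarrow> 'a"  (\<open>_\<^bsup>+\<^esup>\<close> [1000] 1000)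
  where "shift_fwd f t k = f t (k + 1)"

definition shift_bwd :: "(real \<Rightarrow> int \<Rightarrow> 'a) \<Rightarrow> real \<Rightarrow> int \<Rightarrow> 'a"  (\<open>_\<^bsup>-\<^esup>\<close> [1000] 1000)
  where "shift_bwd f t k = f t (k - 1)"

text \<open>Infinite differentiability: every iterated derivative (including the zeroth) is differentiable.\<close>

definition smooth_in_t :: "(real \<Rightarrow> int \<Rightarrow> 'a::real_normed_vector) \<Rightarrow> bool"
  where "smooth_in_t f \<longleftrightarrow>
    (\<forall>k j t. ((\<lambda>g s. vector_derivative g (at s)) ^^ j) (\<lambda>s. f s k) differentiable (at t))"

definition has_t_derivative ::
    "(real \<Rightarrow> int \<Rightarrow> 'a::real_normed_vector) \<Rightarrow> (real \<Rightarrow> int \<Rightarrow> 'a) \<Rightarrow> bool"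
  where "has_t_derivative f g \<longleftrightarrow> (\<forall>t k. ((\<lambda>s. f s k) has_vector_derivative g t k) (at t))"

definition riemann_solution :: "(real \<Rightarrow> int \<Rightarrow> complex ^ 'm ^ 'm) \<Rightarrow> bool"
  where "riemann_solution \<phi> \<longleftrightarrow>
    smooth_in_t \<phi> \<and> has_t_derivative \<phi> (\<lambda>t k. (\<phi>\<^bsup>+\<^esup> t k - \<phi> t k) ** \<phi> t k)"

end

theory Submission
  imports Defs
begin

text \<open>
  The crucial point is that the Sylvester-type relation \<open>X\<^sup>+ A - B X = V U\<close>, imposed at \<open>t = 0\<close>, is
  propagated to all times, because \<open>X\<^sub>t = V\<^sup>- U\<close> and the linear equations for \<open>U\<close> and \<open>V\<close> give both
  sides the same \<open>t\<close>-derivative. In the form \<open>A X\<^sup>-\<^sup>1 = (X\<^sup>+)\<^sup>-\<^sup>1 (B + V U X\<^sup>-\<^sup>1)\<close> it turns the equation for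
  \<open>\<phi>\<close> into an identity of noncommutative algebra. Smoothness of \<open>\<phi>\<close> then needs no smoothness of \<open>X\<^sup>-\<^sup>1\<close>:
  the equation \<open>\<phi>\<^sub>t = (\<phi>\<^sup>+ - \<phi>) \<phi>\<close>, valid for all \<open>k\<close>, bootstraps differentiability.
\<close>

section \<open>Calculus of matrix-valued functions\<close>

text \<open>A bilinear map in finite dimension is bounded. This single fact supplies both the
  distributive laws and the product rule used below.\<close>

lemma bounded_bilinear_matrix_mult:
  "bounded_bilinear ((**) :: complex ^ 'b ^ 'a \<Rightarrow> complex ^ 'c ^ 'b \<Rightarrow> complex ^ 'c ^ 'a)"
proof -
  have "bilinear ((**) :: complex ^ 'b ^ 'a \<Rightarrow> complex ^ 'c ^ 'b \<Rightarrow> complex ^ 'c ^ 'a)"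
    unfolding bilinear_def
    by (auto intro!: linearI
        simp: matrix_matrix_mult_def vec_eq_iff algebra_simps sum.distrib scaleR_sum_right)
  then show ?thesis
    by (simp add: bilinear_conv_bounded_bilinear)
qed

lemmas matrix_mult_simps =
  bounded_bilinear.add_left[OF bounded_bilinear_matrix_mult]
  bounded_bilinear.add_right[OF bounded_bilinear_matrix_mult]
  bounded_bilinear.diff_left[OF bounded_bilinear_matrix_mult]
  bounded_bilinear.diff_right[OF bounded_bilinear_matrix_mult]
  bounded_bilinear.minus_left[OF bounded_bilinear_matrix_mult]
  bounded_bilinear.minus_right[OF bounded_bilinear_matrix_mult]

lemmas has_vector_derivative_matrix_mult =
  bounded_bilinear.has_vector_derivative[OF bounded_bilinear_matrix_mult]

lemma
  fixes M :: "complex ^ 'n ^ 'n"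
  assumes "invertible M"
  shows matrix_inv_right: "M ** matrix_inv M = mat 1"
    and matrix_inv_left: "matrix_inv M ** M = mat 1"
  using someI_ex[OF assms[unfolded invertible_def]] by (auto simp: matrix_inv_def)

lemma differentiable_vec_iff:
  fixes f :: "real \<Rightarrow> 'a::euclidean_space ^ 'n"
  shows "f differentiable (at t) \<longleftrightarrow> (\<forall>i. (\<lambda>s. f s $ i) differentiable (at t))"
proof -
  have "f differentiable (at t) \<longleftrightarrow> (\<forall>i. \<forall>u\<in>Basis. (\<lambda>s. f s $ i \<bullet> u) differentiable (at t))"
    unfolding differentiable_componentwise_within[of f] by (auto simp: Basis_vec_def inner_axis)
  then show ?thesis
    by (simp add: differentiable_componentwise_within[of "\<lambda>s. f s $ _"])
qed

lemma differentiable_matrix_iff: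
  fixes f :: "real \<Rightarrow> complex ^ 'n ^ 'm"
  shows "f differentiable (at t) \<longleftrightarrow> (\<forall>i j. (\<lambda>s. f s $ i $ j) differentiable (at t))"
  by (simp add: differentiable_vec_iff)

lemma differentiable_det:
  fixes f :: "real \<Rightarrow> complex ^ 'n ^ 'n"
  assumes "\<And>i j. (\<lambda>s. f s $ i $ j) differentiable (at t)"
  shows "(\<lambda>s. det (f s)) differentiable (at t)"
proof -
  have "(\<lambda>s. \<Prod>i\<in>UNIV. f s $ i $ p i) differentiable (at t)" for p :: "'n \<Rightarrow> 'n"
  proof -
    from assms obtain f' where f': "\<And>i j. ((\<lambda>s. f s $ i $ j) has_derivative f' i j) (at t)"
      unfolding differentiable_def by metis
    show ?thesis
      by (rule differentiableI[OF has_derivative_prod[OF f']])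
  qed
  then show ?thesis
    unfolding det_def by (intro differentiable_sum differentiable_mult) auto
qed

text \<open>Column \<open>j\<close> of the inverse solves \<open>M *v x = axis j 1\<close>, so
  Cramer's rule applies. Entries become quotients of determinants, which reduces differentiability
  of the inverse to that of determinants.\<close>

lemma matrix_inv_cramer:
  fixes M :: "complex ^ 'n ^ 'n"
  assumes "invertible M"
  shows "matrix_inv M $ i $ j = det (\<chi> a b. if b = i then axis j 1 $ a else M $ a $ b) / det M"
proof -
  have "M *v (matrix_inv M *v axis j 1) = axis j 1"
    by (simp add: matrix_vector_mul_assoc matrix_inv_right[OF assms])
  moreover have "det M \<noteq> 0"
    using assms invertible_det_nz by blast
  ultimately have "matrix_inv M *v axis j 1
      = (\<chi> k. det (\<chi> a b. if b = k then axis j 1 $ a else M $ a $ b) / det M)"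
    by (simp add: cramer)
  moreover have "(matrix_inv M *v axis j 1) $ i = matrix_inv M $ i $ j"
    by (simp add: matrix_vector_mult_def axis_def if_distrib cong: if_cong)
  ultimately show ?thesis
    by simp
qed

text \<open>Cramer's rule gives existence of some derivative \<open>g'\<close>; differentiating
  \<open>f s ** matrix_inv (f s) = mat 1\<close> then determines its value.\<close>

lemma has_vector_derivative_matrix_inv:
  fixes f :: "real \<Rightarrow> complex ^ 'n ^ 'n"
  assumes f: "(f has_vector_derivative f') (at t)" and inv: "\<And>s. invertible (f s)"
  shows "((\<lambda>s. matrix_inv (f s)) has_vector_derivative
    - (matrix_inv (f t) ** f' ** matrix_inv (f t))) (at t)"
proof -
  have entry: "(\<lambda>s. f s $ i $ j) differentiable (at t)" for i j
    using f differentiable_matrix_iff differentiableI_vector by blast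
  have "det (f s) \<noteq> 0" for s
    using inv invertible_det_nz by blast
  moreover have
    "(\<lambda>s. det (\<chi> a b. if b = i then axis j 1 $ a else f s $ a $ b)) differentiable (at t)" for i j
  proof (rule differentiable_det)
    \<comment> \<open>Column \<open>i\<close> is constant in \<open>s\<close>; all other columns are
      those of \<open>f s\<close>.\<close>
    show "(\<lambda>s. (\<chi> a b. if b = i then axis j 1 $ a else f s $ a $ b) $ c $ d)
        differentiable (at t)" for c d
      by (cases "d = i") (simp_all add: entry)
  qed
  ultimately have "(\<lambda>s. matrix_inv (f s)) differentiable (at t)"
    unfolding differentiable_matrix_iff matrix_inv_cramer[OF inv]
    using differentiable_det[OF entry] by (auto intro!: differentiable_divide)
  then obtain g' where g: "((\<lambda>s. matrix_inv (f s)) has_vector_derivative g') (at t)"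
    using vector_derivative_works by blast
  have "((\<lambda>s. f s ** matrix_inv (f s)) has_vector_derivative
      f t ** g' + f' ** matrix_inv (f t)) (at t)"
    by (rule has_vector_derivative_matrix_mult[OF f g])
  then have "((\<lambda>s. mat 1 :: complex ^ 'n ^ 'n) has_vector_derivative
      f t ** g' + f' ** matrix_inv (f t)) (at t)"
    by (simp add: matrix_inv_right[OF inv])
  then have "f t ** g' + f' ** matrix_inv (f t) = 0"
    using has_vector_derivative_const vector_derivative_unique_at by blast
  then have "f t ** g' = - (f' ** matrix_inv (f t))"
    by (simp add: eq_neg_iff_add_eq_0)
  then have "matrix_inv (f t) ** (f t ** g') = - (matrix_inv (f t) ** f' ** matrix_inv (f t))"
    by (simp add: matrix_mult_simps matrix_mul_assoc)
  then have "g' = - (matrix_inv (f t) ** f' ** matrix_inv (f t))"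
    by (simp add: matrix_mul_assoc matrix_inv_left[OF inv])
  with g show ?thesis
    by simp
qed

lemma has_vector_derivative_LBINT:
  fixes f :: "real \<Rightarrow> 'a::euclidean_space"
  assumes "continuous_on UNIV f"
  shows "((\<lambda>u. LBINT s=ereal c..ereal u. f s) has_vector_derivative f t) (at t)"
proof -
  \<comment> \<open>The margin of 1 makes \<open>t\<close> an interior point of
    \<open>{a..b}\<close>, so the derivative within the interval is the full one, also when
    \<open>t\<close> lies to the left of \<open>c\<close>.\<close>
  define a b where "a = min c t - 1" and "b = max c t + 1"
  have "((\<lambda>u. LBINT s=ereal c..ereal u. f s) has_vector_derivative f t) (at t within {a..b})"
    by (rule interval_integral_FTC2)
      (use assms in \<open>auto simp: a_def b_def intro: continuous_on_subset\<close>)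
  moreover have "at t within {a..b} = at t"
    by (rule at_within_interior) (auto simp: a_def b_def)
  ultimately show ?thesis
    by simp
qed

section \<open>Finite orders of differentiability\<close>

text \<open>Since the derivatives of orders 0 to \<open>n\<close> must be differentiable,
  \<open>n + 1\<close> derivatives exist. Smoothness is this property for every \<open>n\<close>,
  which opens it to induction.\<close>

definition times_differentiable :: "nat \<Rightarrow> (real \<Rightarrow> 'a::real_normed_vector) \<Rightarrow> bool"
  where "times_differentiable n f \<longleftrightarrow>
    (\<forall>j\<le>n. \<forall>t. ((\<lambda>g s. vector_derivative g (at s)) ^^ j) f differentiable (at t))"

lemma smooth_in_t_iff: "smooth_in_t f \<longleftrightarrow> (\<forall>n k. times_differentiable n (\<lambda>s. f s k))"
  unfolding smooth_in_t_def times_differentiable_def by blast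

lemma times_differentiable_0: "times_differentiable 0 f \<longleftrightarrow> (\<forall>t. f differentiable (at t))"
  by (simp add: times_differentiable_def)

text \<open>Derivatives are unique, so any pointwise derivative \<open>f'\<close> may replace the
  iterated operator. Inductions on the order can thus peel off the first derivative.\<close>

lemma times_differentiable_Suc:
  "times_differentiable (Suc n) f \<longleftrightarrow>
    (\<exists>f'. (\<forall>t. (f has_vector_derivative f' t) (at t)) \<and> times_differentiable n f')"
proof -
  let ?D = "\<lambda>g s. vector_derivative g (at s)"
  have "times_differentiable (Suc n) f \<longleftrightarrow>
      (\<forall>t. f differentiable (at t)) \<and> times_differentiable n (?D f)"
  proof -
    have "(\<forall>j\<le>Suc n. P j) \<longleftrightarrow> P 0 \<and> (\<forall>j\<le>n. P (Suc j))" for P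
      by (metis Suc_le_mono le0 not0_implies_Suc)
    then show ?thesis
      unfolding times_differentiable_def by (simp add: funpow_Suc_right del: funpow.simps(2))
  qed
  also have "\<dots> \<longleftrightarrow>
      (\<exists>f'. (\<forall>t. (f has_vector_derivative f' t) (at t)) \<and> times_differentiable n f')"
  proof
    assume "(\<forall>t. f differentiable (at t)) \<and> times_differentiable n (?D f)"
    then show "\<exists>f'. (\<forall>t. (f has_vector_derivative f' t) (at t)) \<and> times_differentiable n f'"
      by (intro exI[of _ "?D f"]) (simp add: vector_derivative_works[symmetric])
  next
    assume "\<exists>f'. (\<forall>t. (f has_vector_derivative f' t) (at t)) \<and> times_differentiable n f'"
    then obtain f' where f': "\<And>t. (f has_vector_derivative f' t) (at t)"
      and n: "times_differentiable n f'" by blast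
    have "?D f = f'"
      using f' vector_derivative_at by blast
    with f' n show "(\<forall>t. f differentiable (at t)) \<and> times_differentiable n (?D f)"
      using differentiableI_vector by auto
  qed
  finally show ?thesis .
qed

lemma times_differentiable_SucI:
  assumes "\<And>t. (f has_vector_derivative f' t) (at t)" "times_differentiable n f'"
  shows "times_differentiable (Suc n) f"
  using assms unfolding times_differentiable_Suc by (intro exI[of _ f']) simp

lemma times_differentiable_SucD: "times_differentiable (Suc n) f \<Longrightarrow> times_differentiable n f"
  by (simp add: times_differentiable_def)

lemma times_differentiable_add:
  assumes "times_differentiable n f" "times_differentiable n g"
  shows "times_differentiable n (\<lambda>s. f s + g s)"
  using assms
proof (induction n arbitrary: f g)
  case 0
  then show ?case by (simp add: times_differentiable_0)
next
  case (Suc n)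
  then obtain f' g' where "\<And>t. (f has_vector_derivative f' t) (at t)"
    and "\<And>t. (g has_vector_derivative g' t) (at t)"
    and "times_differentiable n f'" "times_differentiable n g'"
    unfolding times_differentiable_Suc by blast
  then show ?case
    by (intro times_differentiable_SucI[OF has_vector_derivative_add] Suc.IH)
qed

lemma times_differentiable_diff:
  assumes "times_differentiable n f" "times_differentiable n g"
  shows "times_differentiable n (\<lambda>s. f s - g s)"
  using assms
proof (induction n arbitrary: f g)
  case 0
  then show ?case by (simp add: times_differentiable_0)
next
  case (Suc n)
  then obtain f' g' where "\<And>t. (f has_vector_derivative f' t) (at t)"
    and "\<And>t. (g has_vector_derivative g' t) (at t)"
    and "times_differentiable n f'" "times_differentiable n g'"
    unfolding times_differentiable_Suc by blast
  then show ?case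
    by (intro times_differentiable_SucI[OF has_vector_derivative_diff] Suc.IH)
qed

lemma times_differentiable_bilinear:
  assumes h: "bounded_bilinear h"
    and "times_differentiable n f" "times_differentiable n g"
  shows "times_differentiable n (\<lambda>s. h (f s) (g s))"
  using assms(2,3)
proof (induction n arbitrary: f g)
  case 0
  then show ?case
    using bounded_bilinear.FDERIV[OF h]
    unfolding times_differentiable_0 differentiable_def by blast
next
  case (Suc n)
  then obtain f' g' where f': "\<And>t. (f has_vector_derivative f' t) (at t)"
    and g': "\<And>t. (g has_vector_derivative g' t) (at t)"
    and n: "times_differentiable n f'" "times_differentiable n g'"
    unfolding times_differentiable_Suc by blast
  have "((\<lambda>s. h (f s) (g s)) has_vector_derivative h (f t) (g' t) + h (f' t) (g t)) (at t)" for t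
    by (rule bounded_bilinear.has_vector_derivative[OF h f' g'])
  \<comment> \<open>The undifferentiated factors \<open>f\<close> and \<open>g\<close> have order
    \<open>Suc n\<close>, hence also order \<open>n\<close>, so the induction hypothesis covers both
    products.\<close>
  moreover have "times_differentiable n (\<lambda>t. h (f t) (g' t) + h (f' t) (g t))"
    using n Suc.prems by (intro times_differentiable_add Suc.IH) (auto dest: times_differentiable_SucD)
  ultimately show ?case
    by (rule times_differentiable_SucI)
qed

lemma riemann_solutionI:
  fixes \<phi> :: "real \<Rightarrow> int \<Rightarrow> complex ^ 'm ^ 'm"
  assumes \<phi>: "has_t_derivative \<phi> (\<lambda>t k. (\<phi>\<^bsup>+\<^esup> t k - \<phi> t k) ** \<phi> t k)"
  shows "riemann_solution \<phi>"
proof -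
  have "times_differentiable n (\<lambda>s. \<phi> s k)" for n k
  \<comment> \<open>The right side at \<open>k\<close> contains \<open>\<phi>\<close> at
    \<open>k + 1\<close>, so the induction hypothesis is needed at all sites at once.\<close>
  proof (induction n arbitrary: k)
    case 0
    show ?case
      using \<phi> differentiableI_vector unfolding times_differentiable_0 has_t_derivative_def by blast
  next
    case (Suc n)
    then have "times_differentiable n (\<lambda>s. (\<phi>\<^bsup>+\<^esup> s k - \<phi> s k) ** \<phi> s k)"
      unfolding shift_fwd_def
      by (intro times_differentiable_bilinear[OF bounded_bilinear_matrix_mult]
          times_differentiable_diff)
    with \<phi> show ?case
      unfolding has_t_derivative_def by (intro times_differentiable_SucI) auto
  qed
  with \<phi> show ?thesis
    unfolding riemann_solution_def smooth_in_t_iff by blast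
qed

section \<open>The dressing transformation\<close>

text \<open>Here \<open>Z\<close> stands for \<open>V\<^sup>-\<close>, and the subscript 1 for a forward shift.\<close>

lemma dressing_identity:
  fixes p p1 :: "complex ^ 'm ^ 'm" and U U1 :: "complex ^ 'n ^ 'm"
    and V Z :: "complex ^ 'm ^ 'n" and A B X X1 Y Y1 :: "complex ^ 'n ^ 'n"
  assumes BZ: "B ** Z = V ** p" and X1: "X1 ** A - B ** X = V ** U"
    and XY: "X ** Y = mat 1" and YX: "Y1 ** X1 = mat 1"
  shows "(p1 - p) ** p + (U ** Y ** - (Z ** p)
      + (U ** - (Y ** (Z ** U) ** Y) + (U1 ** A + (p1 - p) ** U) ** Y) ** Z)
    = (p1 + U1 ** Y1 ** V - (p + U ** Y ** Z)) ** (p + U ** Y ** Z)"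
proof -
  have "X1 ** A = B ** X + V ** U"
    using X1 by (simp add: algebra_simps)
  \<comment> \<open>The outer factors are chosen to cancel \<open>X1\<close> on the left side and
    \<open>X\<close> in the first term on the right.\<close>
  then have "Y1 ** (X1 ** A) ** Y = Y1 ** (B ** X + V ** U) ** Y"
    by simp
  then have "Y1 ** X1 ** A ** Y = Y1 ** B ** (X ** Y) + Y1 ** V ** U ** Y"
    by (simp add: matrix_mult_simps matrix_mul_assoc)
  then have "A ** Y = Y1 ** B + Y1 ** V ** U ** Y"
    by (simp add: XY YX)
  \<comment> \<open>The factor \<open>Z\<close> on the right meets \<open>B\<close>, so that
    \<open>BZ\<close> can trade \<open>B ** Z\<close> for \<open>V ** p\<close>.\<close>
  then have "U1 ** (A ** Y) ** Z = U1 ** Y1 ** (B ** Z) + U1 ** Y1 ** V ** U ** Y ** Z"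
    by (simp add: matrix_mult_simps matrix_mul_assoc)
  then have "U1 ** A ** Y ** Z = U1 ** Y1 ** V ** p + U1 ** Y1 ** V ** U ** Y ** Z"
    by (simp add: BZ matrix_mul_assoc)
  \<comment> \<open>After expansion all other terms agree: the left side keeps
    \<open>U1 ** A ** Y ** Z\<close>, the right side the two terms with \<open>Y1\<close>.\<close>
  then show ?thesis
    by (simp add: matrix_mult_simps matrix_mul_assoc)
qed

theorem proposition4p5:
  fixes \<phi>0 \<phi> :: "real \<Rightarrow> int \<Rightarrow> complex ^ 'm ^ 'm"
    and A B :: "complex ^ 'n ^ 'n"
    and U :: "real \<Rightarrow> int \<Rightarrow> complex ^ 'n ^ 'm"
    and V :: "real \<Rightarrow> int \<Rightarrow> complex ^ 'm ^ 'n"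
    and C :: "int \<Rightarrow> complex ^ 'n ^ 'n"
    and X :: "real \<Rightarrow> int \<Rightarrow> complex ^ 'n ^ 'n"
  assumes "riemann_solution \<phi>0"
    and "smooth_in_t U" and "smooth_in_t V"
    and "has_t_derivative U (\<lambda>t k. U\<^bsup>+\<^esup> t k ** A + (\<phi>0\<^bsup>+\<^esup> t k - \<phi>0 t k) ** U t k)"
    and "has_t_derivative V (\<lambda>t k. - (V t k ** \<phi>0\<^bsup>+\<^esup> t k))"
    and "\<And>t k. B ** V\<^bsup>-\<^esup> t k = V t k ** \<phi>0 t k"
    and "\<And>k. C k ** A - B ** C (k - 1) = V 0 k ** U 0 k"
    and "\<And>t k. X t k = C (k - 1) + (LBINT s=0..t. V\<^bsup>-\<^esup> s k ** U s k)"
    and "\<And>t k. invertible (X t k)"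
    and "\<And>t k. \<phi> t k = \<phi>0 t k + U t k ** matrix_inv (X t k) ** V\<^bsup>-\<^esup> t k"
  shows "riemann_solution \<phi>"
proof (rule riemann_solutionI)
  note BV = assms(6)[unfolded shift_bwd_def] and X = assms(8)[unfolded shift_bwd_def]
    and inv = assms(9) and \<phi> = assms(10)[unfolded shift_bwd_def]
  have U': "((\<lambda>s. U s k) has_vector_derivative
      U t (k + 1) ** A + (\<phi>0 t (k + 1) - \<phi>0 t k) ** U t k) (at t)" for t k
    using assms(4) by (simp add: has_t_derivative_def shift_fwd_def)
  have V': "((\<lambda>s. V s k) has_vector_derivative - (V t k ** \<phi>0 t (k + 1))) (at t)" for t k
    using assms(5) by (simp add: has_t_derivative_def shift_fwd_def)
  have \<phi>0': "((\<lambda>s. \<phi>0 s k) has_vector_derivative (\<phi>0 t (k + 1) - \<phi>0 t k) ** \<phi>0 t k) (at t)" for t k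
    using assms(1) by (simp add: riemann_solution_def has_t_derivative_def shift_fwd_def)

  have X': "((\<lambda>s. X s k) has_vector_derivative V t (k - 1) ** U t k) (at t)" for t k
  proof -
    have "continuous_on UNIV (\<lambda>s. V s (k - 1) ** U s k)"
      using has_vector_derivative_matrix_mult[OF V' U'] has_vector_derivative_continuous
      by (blast intro: continuous_at_imp_continuous_on)
    from has_vector_derivative_LBINT[OF this, of 0] show ?thesis
      unfolding X zero_ereal_def by (simp add: has_vector_derivative_add_const add.commute[of "C _"])
  qed

  have sylvester: "X t (k + 1) ** A - B ** X t k = V t k ** U t k" for t k
  proof -
    define F where "F s = X s (k + 1) ** A - B ** X s k - V s k ** U s k" for s
    have "(F has_vector_derivative 0) (at s)" for s
    proof -
      \<comment> \<open>The zeros are the derivatives of \<open>A\<close> and \<open>B\<close>. The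
        terms with \<open>U s (k + 1)\<close> cancel, as do those with
        \<open>\<phi>0 s (k + 1)\<close>; the rest is
        \<open>V s k ** \<phi>0 s k ** U s k - B ** V s (k - 1) ** U s k\<close>, which vanishes by
        \<open>BV\<close>.\<close>
      have "(F has_vector_derivative
          X s (k + 1) ** 0 + (V s k ** U s (k + 1)) ** A
          - (B ** (V s (k - 1) ** U s k) + 0 ** X s k)
          - (V s k ** (U s (k + 1) ** A + (\<phi>0 s (k + 1) - \<phi>0 s k) ** U s k)
            + - (V s k ** \<phi>0 s (k + 1)) ** U s k)) (at s)"
        unfolding F_def
        using X'[of "k + 1" s] U' V'
        by (intro has_vector_derivative_diff has_vector_derivative_matrix_mult X'
            has_vector_derivative_const) auto
      then show ?thesis
        by (simp add: matrix_mult_simps matrix_mul_assoc BV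
            bounded_bilinear.zero_left[OF bounded_bilinear_matrix_mult]
            bounded_bilinear.zero_right[OF bounded_bilinear_matrix_mult])
    qed
    then have "F t = F 0"
      by (metis UNIV_I convex_UNIV has_vector_derivative_zero_constant)
    \<comment> \<open>At time 0 the integrals vanish, leaving \<open>C k\<close> for
      \<open>X 0 (k + 1)\<close> and \<open>C (k - 1)\<close> for \<open>X 0 k\<close>: exactly the
      condition on \<open>C\<close>.\<close>
    also have "\<dots> = 0"
      using assms(7)[of k] by (simp add: F_def X zero_ereal_def)
    finally show ?thesis
      by (simp add: F_def)
  qed

  show "has_t_derivative \<phi> (\<lambda>t k. (\<phi>\<^bsup>+\<^esup> t k - \<phi> t k) ** \<phi> t k)"
    unfolding has_t_derivative_def
  proof (intro allI)
    fix t k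
    let ?Y = "matrix_inv (X t k)"
    have Z': "((\<lambda>s. V s (k - 1)) has_vector_derivative - (V t (k - 1) ** \<phi>0 t k)) (at t)"
      using V'[of "k - 1" t] by simp
    \<comment> \<open>The nesting left by the product rule is kept, so that this is literally the
      left side of \<open>dressing_identity\<close> with \<open>Z = V t (k - 1)\<close> and
      \<open>Y = ?Y\<close>.\<close>
    have "((\<lambda>s. \<phi> s k) has_vector_derivative (\<phi>0 t (k + 1) - \<phi>0 t k) ** \<phi>0 t k
        + (U t k ** ?Y ** - (V t (k - 1) ** \<phi>0 t k)
          + (U t k ** - (?Y ** (V t (k - 1) ** U t k) ** ?Y)
            + (U t (k + 1) ** A + (\<phi>0 t (k + 1) - \<phi>0 t k) ** U t k) ** ?Y) ** V t (k - 1)))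
      (at t)"
      unfolding \<phi>
      by (intro has_vector_derivative_add has_vector_derivative_matrix_mult \<phi>0' U' Z'
          has_vector_derivative_matrix_inv X' inv)
    moreover have "\<phi>\<^bsup>+\<^esup> t k
        = \<phi>0 t (k + 1) + U t (k + 1) ** matrix_inv (X t (k + 1)) ** V t k"
      by (simp add: shift_fwd_def \<phi>)
    ultimately show
      "((\<lambda>s. \<phi> s k) has_vector_derivative (\<phi>\<^bsup>+\<^esup> t k - \<phi> t k) ** \<phi> t k) (at t)"
      using dressing_identity[OF BV sylvester matrix_inv_right[OF inv] matrix_inv_left[OF inv]]
      by (simp add: \<phi>)
  qed
qed

end
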